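(* Let $S(q)$ be the formal power series defined in the context, and write $\Delta^{(\ell)}_n=\Delta^{(\ell)}_n(S)$. (1) For each $\ell\in\{0,1,2,3\}$ the sequence $(\Delta^{(\ell)}_n)_{n\ge0}$ is $12$-periodic, $\Delta^{(\ell)}_{n+12}=\Delta^{(\ell)}_n$, and consists only of $-1,0,1$. The first twelve terms ($n=0,\dots,11$) are: $\Delta^{(0)}_n:\ 1,1,-1,-1,1,0,-1,0,0,1,0,-1$; $\Delta^{(1)}_n:\ 1,1,0,-1,0,0,-1,0,1,1,-1,-1$; $\Delta^{(2)}_n:\ 1,0,0,-1,0,1,-1,-1,1,1,-1,0$; $\Delta^{(3)}_n:\ 1,0,-1,-1,1,1,-1,-1,0,1,0,0$. (2) For $\ell=0,1,2$ and all $n\ge0$: $\Delta^{(\ell+1)}_n=(-1)^{n-1}\Delta^{(\ell)}_{n+3}$.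
   Context: $S(q)\in\mathbb{Z}[[q]]$ is the Taylor expansion at $q=0$ of $\frac{q^3+2q-1+\sqrt{(1-q+q^2)(1+q+4q^2+q^3+q^4)}}{2q}$ (square-root branch equal to $1$ at $q=0$); equivalently, the unique formal power series satisfying $q\,S(q)^2+(1-2q-q^3)S(q)=1$. It begins $S(q)=1+q+q^4-2q^6+q^7+4q^8-\cdots$ (it is the $q$-deformation of the silver ratio $1+\sqrt2$). For a power series $f=\sum_{i\ge0}f_iq^i$ and integers $\ell,n\ge 0$, $\Delta^{(\ell)}_n(f)$ is the determinant of the $n\times n$ matrix $(f_{\ell+i+j})_{0\le i,j\le n-1}$, with $\Delta^{(\ell)}_0(f)=1$. *)

theory Defs
  imports
    "HOL-Complex_Analysis.Laurent_Convergence"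
    "Jordan_Normal_Form.Determinant"
begin

text \<open>The principal square root \<^const>\<open>csqrt\<close> is analytic near \<open>1\<close> and equals \<open>1\<close> there, so it is
  the required branch near \<open>q = 0\<close>. The quotient has a removable singularity at \<open>q = 0\<close>, filled in
  by its limit \<open>1\<close>.\<close>

definition silver_fun :: "complex \<Rightarrow> complex" where
  "silver_fun q =
     (if q = 0 then 1
      else (q^3 + 2*q - 1 + csqrt ((1 - q + q^2) * (1 + q + 4*q^2 + q^3 + q^4))) / (2*q))"

definition silver_fps :: "int fps" where
  "silver_fps = (THE S. silver_fun has_fps_expansion Abs_fps (\<lambda>n. of_int (fps_nth S n)))"

definition hankel_det :: "'a::comm_ring_1 fps \<Rightarrow> nat \<Rightarrow> nat \<Rightarrow> 'a" where
  "hankel_det f l n = Determinant.det (mat n n (\<lambda>(i, j). fps_nth f (l + i + j)))"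

lemma hankel_det_0: "hankel_det f l 0 = 1"
  by (simp add: hankel_det_def)

text \<open>The remaining facts show that the definite description defining \<open>silver_fps\<close> denotes, and
  that it is the unique solution of the quadratic equation.\<close>

fun silver_coeff :: "nat \<Rightarrow> int" where
  "silver_coeff n =
     (if n = 0 then 1
      else 2 * silver_coeff (n - 1) + (if n \<ge> 3 then silver_coeff (n - 3) else 0)
           - (\<Sum>i<n. silver_coeff i * silver_coeff (n - 1 - i)))"

declare silver_coeff.simps [simp del]

lemma silver_coeff_equation:
  defines "S \<equiv> Abs_fps silver_coeff"
  shows "fps_X * S^2 + (1 - 2 * fps_X - fps_X^3) * S = 1"
proof (rule fps_ext)
  fix n
  have eq: "fps_X * S^2 + (1 - 2 * fps_X - fps_X^3) * S
      = fps_X * (S * S) + S - fps_const 2 * (fps_X * S) - fps_X^3 * S"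
    by (simp add: algebra_simps power2_eq_square fps_numeral_fps_const)
  show "fps_nth (fps_X * S^2 + (1 - 2 * fps_X - fps_X^3) * S) n = fps_nth 1 n"
  proof (cases n)
    case 0
    then show ?thesis
      unfolding eq by (simp add: S_def silver_coeff.simps fps_X_power_mult_nth)
  next
    case (Suc m)
    have "fps_nth (S * S) m = (\<Sum>i<n. silver_coeff i * silver_coeff (n - 1 - i))"
      by (simp add: fps_mult_nth S_def Suc lessThan_Suc_atMost atLeast0AtMost)
    moreover have "silver_coeff n =
        2 * silver_coeff m + (if n \<ge> 3 then silver_coeff (n - 3) else 0)
          - (\<Sum>i<n. silver_coeff i * silver_coeff (n - 1 - i))"
      by (subst silver_coeff.simps) (simp add: Suc del: sum.lessThan_Suc)
    moreover have "fps_nth (fps_X^3 * S) n = (if n \<ge> 3 then silver_coeff (n - 3) else 0)"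
      by (simp add: fps_X_power_mult_nth S_def)
    moreover have "fps_nth S n = silver_coeff n" "fps_nth S m = silver_coeff m"
      by (simp_all add: S_def)
    ultimately show ?thesis
      unfolding eq fps_sub_nth fps_add_nth fps_mult_left_const_nth fps_X_mult_nth
      by (simp only: Suc nat.simps if_False diff_Suc_1 fps_one_nth)
  qed
qed

lemma silver_equation_unique:
  fixes S T :: "'a::idom fps"
  assumes "fps_X * S^2 + (1 - 2 * fps_X - fps_X^3) * S = 1"
    and "fps_X * T^2 + (1 - 2 * fps_X - fps_X^3) * T = 1"
  shows "S = T"
proof -
  have "(S - T) * (fps_X * (S + T) + 1 - 2 * fps_X - fps_X^3) = 0"
  proof -
    have "(S - T) * (fps_X * (S + T) + 1 - 2 * fps_X - fps_X^3)
        = (fps_X * S^2 + (1 - 2 * fps_X - fps_X^3) * S)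
          - (fps_X * T^2 + (1 - 2 * fps_X - fps_X^3) * T)"
      by (simp add: algebra_simps power2_eq_square)
    then show ?thesis by (simp only: assms diff_self)
  qed
  moreover have "fps_nth (fps_X * (S + T) + 1 - 2 * fps_X - fps_X^3) 0 \<noteq> 0"
    by (simp add: fps_numeral_fps_const)
  then have "fps_X * (S + T) + 1 - 2 * fps_X - fps_X^3 \<noteq> 0"
    by (metis fps_zero_nth)
  ultimately show ?thesis by simp
qed

lemma silver_fun_expansion:
  fixes R :: "complex fps"
  assumes R: "fps_X * R^2 + (1 - 2 * fps_X - fps_X^3) * R = 1"
  shows "silver_fun has_fps_expansion R"
proof -
  define p :: "complex \<Rightarrow> complex"
    where "p = (\<lambda>q. (1 - q + q^2) * (1 + q + 4*q^2 + q^3 + q^4))"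
  define P :: "complex fps"
    where "P = (1 - fps_X + fps_X^2) * (1 + fps_X + 4*fps_X^2 + fps_X^3 + fps_X^4)"
  have pP: "p has_fps_expansion P"
    unfolding p_def P_def by (intro fps_expansion_intros)
  have p0: "p 0 = 1" by (simp add: p_def)
  have "(\<lambda>q. csqrt (p q)) analytic_on {0}"
    unfolding p_def by (intro analytic_intros) (auto simp: complex_nonpos_Reals_iff)
  then obtain F where F: "(\<lambda>q. csqrt (p q)) has_fps_expansion F"
    using analytic_at_imp_has_fps_expansion_0 by blast
  have "(\<lambda>q. csqrt (p q) * csqrt (p q)) has_fps_expansion F * F"
    by (intro has_fps_expansion_mult F)
  then have "p has_fps_expansion F * F"
    by (simp add: power2_eq_square [symmetric])
  with pP have FP: "F * F = P"
    using fps_expansion_unique_complex by blast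
  have F0: "fps_nth F 0 = 1"
    using has_fps_expansion_imp_0_eq_fps_nth_0 [OF F] p0 by simp
  define G where "G = 2 * fps_X * R + 1 - 2 * fps_X - fps_X^3"
  have "G * G = P"
  proof -
    have "G * G = 4 * fps_X * (fps_X * R^2 + (1 - 2 * fps_X - fps_X^3) * R)
        + (1 - 2 * fps_X - fps_X^3)^2"
      unfolding G_def by (simp add: algebra_simps power2_eq_square)
    also have "\<dots> = P"
      unfolding R P_def by (simp add: algebra_simps power2_eq_square power3_eq_cube power4_eq_xxxx)
    finally show ?thesis .
  qed
  with FP have "(F - G) * (F + G) = 0"
    by (simp add: algebra_simps)
  moreover have "fps_nth (F + G) 0 \<noteq> 0"
    by (simp add: F0 G_def fps_numeral_fps_const)
  then have "F + G \<noteq> 0" by (metis fps_zero_nth)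
  ultimately have "F = G" by simp
  define H where "H = fps_const (1/2) * (fps_X^3 + 2 * fps_X - 1 + F)"
  have H: "H = fps_X * R"
    unfolding H_def \<open>F = G\<close> G_def
    by (simp add: fps_eq_iff fps_numeral_fps_const mult.assoc)
  have hH: "(\<lambda>q. 1/2 * (q^3 + 2*q - 1 + csqrt (p q))) has_fps_expansion H"
    unfolding H_def by (intro fps_expansion_intros F)
  have R0: "fps_nth R 0 = 1"
    using arg_cong [OF R, of "\<lambda>f. fps_nth f 0"] by (simp add: fps_numeral_fps_const)
  then have "R \<noteq> 0" by auto
  then have "1 \<le> subdegree H"
    unfolding H by (subst subdegree_mult) auto
  moreover have "1 = fps_nth H 1"
    unfolding H by (simp add: R0)
  ultimately have "(\<lambda>q. if q = 0 then 1 else (1/2 * (q^3 + 2*q - 1 + csqrt (p q))) / q^1)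
      has_fps_expansion fps_shift 1 H"
    by (rule has_fps_expansion_shift [OF hH])
  also have "fps_shift 1 H = R"
    unfolding H by (simp add: fps_eq_iff)
  also have "(\<lambda>q. if q = 0 then 1 else (1/2 * (q^3 + 2*q - 1 + csqrt (p q))) / q^1) = silver_fun"
    by (auto simp: silver_fun_def p_def fun_eq_iff)
  finally show ?thesis .
qed

lemma silver_coeff_expansion:
  "silver_fun has_fps_expansion Abs_fps (\<lambda>n. of_int (silver_coeff n))"
proof -
  define C :: "int fps \<Rightarrow> complex fps" where "C = (\<lambda>S. Abs_fps (\<lambda>n. of_int (fps_nth S n)))"
  have C_simps: "C (f + g) = C f + C g" "C (f - g) = C f - C g" "C (f * g) = C f * C g"
    "C 1 = 1" "C fps_X = fps_X" "C 2 = 2" for f g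
    by (simp_all add: C_def fps_eq_iff fps_mult_nth fps_numeral_fps_const)
  have C_power: "C (f ^ k) = C f ^ k" for f k
    by (induction k) (simp_all add: C_simps)
  have "C (fps_X * (Abs_fps silver_coeff)^2
           + (1 - 2 * fps_X - fps_X^3) * Abs_fps silver_coeff) = C 1"
    by (simp only: silver_coeff_equation)
  then have "silver_fun has_fps_expansion C (Abs_fps silver_coeff)"
    by (intro silver_fun_expansion) (simp add: C_simps C_power)
  then show ?thesis by (simp add: C_def)
qed

lemma silver_fps_eq: "silver_fps = Abs_fps silver_coeff"
  unfolding silver_fps_def
proof (rule the_equality)
  show "silver_fun has_fps_expansion Abs_fps (\<lambda>n. of_int (fps_nth (Abs_fps silver_coeff) n))"
    using silver_coeff_expansion by simp
next
  fix S :: "int fps"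
  assume "silver_fun has_fps_expansion Abs_fps (\<lambda>n. of_int (fps_nth S n))"
  then have "Abs_fps (\<lambda>n. of_int (fps_nth S n) :: complex) = Abs_fps (\<lambda>n. of_int (silver_coeff n))"
    using silver_coeff_expansion fps_expansion_unique_complex by blast
  then show "S = Abs_fps silver_coeff"
    by (simp add: fps_eq_iff)
qed

lemma silver_fps_expansion:
  "silver_fun has_fps_expansion Abs_fps (\<lambda>n. of_int (fps_nth silver_fps n))"
  using silver_coeff_expansion by (simp add: silver_fps_eq)

lemma silver_fps_iff:
  "fps_X * S^2 + (1 - 2 * fps_X - fps_X^3) * S = 1 \<longleftrightarrow> S = silver_fps"
  using silver_coeff_equation silver_equation_unique silver_fps_eq by metis

end

theory Submission
  imports Defs
begin

text \<open>If \<open>F = q^d / (u - q^(d+2) G)\<close> with \<open>u(0) = 1\<close> and \<open>deg u \<le> d + 1\<close>, then the Hankel determinants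
  of \<open>F\<close> of size \<open>n + d + 1\<close> are, up to an explicit sign, those of \<open>G\<close> of size \<open>n\<close>. Write \<open>S\<^sub>l\<close> for
  \<open>S\<close> with its first \<open>l\<close> coefficients removed. The quadratic equation for \<open>S\<close> shows that one to three
  such steps, of total size \<open>3\<close>, lead from \<open>S\<^sub>l\<close> to \<open>- S\<^sub>l\<^sub>+\<^sub>1\<close> for \<open>l = 0, 1, 2\<close>, and
  from \<open>S\<^sub>3\<close> to a series with the same Hankel determinants as \<open>- S\<^sub>0\<close>: the first step takes both of
  these to the same series, up to sign. Hence \<open>\<Delta>\<close> satisfies a cyclic recursion in \<open>l\<close>; going round once
  gives period \<open>12\<close>, and the values for \<open>n \<le> 2\<close> determine all others.\<close>

section \<open>Hankel determinants of a power of x divided by a power series\<close>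

text \<open>Only the last entry of the first row can be nonzero, and deleting its row and column
  leaves the same shape, one smaller. The cofactor signs accumulate to a triangular
  exponent.\<close>

lemma det_antitriangular_toeplitz:
  fixes a :: "nat \<Rightarrow> 'a::comm_ring_1"
  shows "det (mat (Suc d) (Suc d) (\<lambda>(i, j). if d \<le> i + j then a (i + j - d) else 0))
       = (-1) ^ (d * Suc d div 2) * a 0 ^ Suc d"
proof (induction d)
  case 0
  show ?case by (subst det_single) auto
next
  case (Suc d)
  define A where "A = (\<lambda>d. mat (Suc d) (Suc d)
    (\<lambda>(i, j). if d \<le> i + j then a (i + j - d) else 0))"
  have "det (A (Suc d)) = (\<Sum>j<Suc (Suc d). A (Suc d) $$ (0, j) * cofactor (A (Suc d)) 0 j)"
    by (rule laplace_expansion_row) (auto simp: A_def)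
  also have "\<dots> = A (Suc d) $$ (0, Suc d) * cofactor (A (Suc d)) 0 (Suc d)"
    by (subst sum.lessThan_Suc, subst sum.neutral) (auto simp: A_def)
  also have "mat_delete (A (Suc d)) 0 (Suc d) = A d"
    by (rule eq_matI) (auto simp: A_def mat_delete_def)
  then have "cofactor (A (Suc d)) 0 (Suc d) = (-1) ^ Suc d * det (A d)"
    by (simp add: cofactor_def)
  also have "A (Suc d) $$ (0, Suc d) = a 0"
    by (simp add: A_def)
  also have "det (A d) = (-1) ^ (d * Suc d div 2) * a 0 ^ Suc d"
    unfolding A_def by (rule Suc.IH)
  finally have "det (A (Suc d)) = (-1) ^ (Suc d + d * Suc d div 2) * a 0 ^ Suc (Suc d)"
    by (simp add: power_add mult_ac)
  also have "Suc d + d * Suc d div 2 = Suc d * Suc (Suc d) div 2"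
    by (simp add: algebra_simps)
  finally show ?case
    by (simp only: A_def)
qed

text \<open>The sum is the \<open>(i, j)\<close> entry of the Hankel matrix of \<open>F\<close>
  between the lower triangular Toeplitz matrix of \<open>D\<close> and its transpose. Entries
  \<open>(i, Suc j)\<close> and \<open>(Suc i, j)\<close> differ only by boundary terms at
  \<open>i = d\<close> or \<open>j = d\<close>, hence the induction on \<open>j\<close> for
  arbitrary \<open>i\<close>.\<close>

lemma toeplitz_hankel_toeplitz_entry:
  fixes F D :: "'a::comm_ring_1 fps"
  assumes FD: "F * D = fps_X ^ d"
  shows "(\<Sum>a\<le>i. fps_nth D (i - a) * fps_nth (D * fps_shift a F) j) =
    (if i \<le> d \<and> j \<le> d then if d \<le> i + j then fps_nth D (i + j - d) else 0
     else if d < i \<and> d < j then - fps_nth D (i + j - d) else 0)"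
proof (induction j arbitrary: i)
  have FD_nth: "(\<Sum>a\<le>i. fps_nth D (i - a) * fps_nth F a) = (if i = d then 1 else 0)" for i
  proof -
    have "(\<Sum>a\<le>i. fps_nth D (i - a) * fps_nth F a) = fps_nth (F * D) i"
      unfolding fps_mult_nth atLeast0AtMost by (simp add: mult.commute)
    then show ?thesis by (simp add: FD)
  qed
  {
    case 0
    have "(\<Sum>a\<le>i. fps_nth D (i - a) * fps_nth (D * fps_shift a F) 0)
        = fps_nth D 0 * (\<Sum>a\<le>i. fps_nth D (i - a) * fps_nth F a)"
      by (simp add: sum_distrib_left mult_ac)
    then show ?case
      by (auto simp: FD_nth)
  next
    case (Suc j)
    define E where "E = (\<lambda>a. D * fps_shift a F)"
    have shift: "fps_shift a F = fps_const (fps_nth F a) + fps_X * fps_shift (Suc a) F" for a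
      by (rule fps_ext) (auto simp: fps_X_mult_nth)
    have E_Suc: "fps_nth (E a) (Suc j) = fps_nth F a * fps_nth D (Suc j) + fps_nth (E (Suc a)) j" for a
    proof -
      have "E a = fps_const (fps_nth F a) * D + fps_X * E (Suc a)"
        unfolding E_def by (subst shift) (simp add: algebra_simps)
      then show ?thesis by simp
    qed
    have E_0: "fps_nth (E 0) j = (if j = d then 1 else 0)"
      using FD by (simp add: E_def mult.commute)
    have "(\<Sum>a\<le>i. fps_nth D (i - a) * fps_nth (E a) (Suc j))
        = (\<Sum>a\<le>i. fps_nth D (i - a) * fps_nth F a) * fps_nth D (Suc j)
          + (\<Sum>a\<le>i. fps_nth D (i - a) * fps_nth (E (Suc a)) j)"
      unfolding E_Suc by (simp add: sum.distrib sum_distrib_left sum_distrib_right algebra_simps)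
    also have "(\<Sum>a\<le>i. fps_nth D (i - a) * fps_nth (E (Suc a)) j)
        = (\<Sum>a\<le>Suc i. fps_nth D (Suc i - a) * fps_nth (E a) j)
          - fps_nth D (Suc i) * fps_nth (E 0) j"
      by (subst sum.atMost_Suc_shift) simp
    also have "(\<Sum>a\<le>Suc i. fps_nth D (Suc i - a) * fps_nth (E a) j) =
        (if Suc i \<le> d \<and> j \<le> d then if d \<le> Suc i + j then fps_nth D (Suc i + j - d) else 0
         else if d < Suc i \<and> d < j then - fps_nth D (Suc i + j - d) else 0)"
      unfolding E_def by (rule Suc.IH)
    finally show ?case
      unfolding FD_nth E_0
      by (cases i d rule: linorder_cases; cases j d rule: linorder_cases) (auto simp: E_def)
  }
qed

text \<open>The Toeplitz matrix of \<open>D\<close> on both sides makes the Hankel matrix of \<open>F = x^d / D\<close> block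
  diagonal. In generating functions,
  \<open>D(x) D(y) (x F(x) - y F(y)) / (x - y) = (x^(d+1) D(y) - y^(d+1) D(x)) / (x - y)\<close>, where the
  coefficients of \<open>D\<close> up to degree \<open>d + 1\<close> contribute an antitriangular block of size \<open>d + 1\<close> and the
  remaining ones a Hankel block.\<close>

lemma hankel_det_power_over:
  fixes F D :: "'a::idom fps"
  assumes FD: "F * D = fps_X ^ d" and D0: "fps_nth D 0 = 1"
  shows "hankel_det F 0 (n + Suc d) = (-1) ^ (n + d * Suc d div 2) * hankel_det D (d + 2) n"
proof -
  define m where "m = Suc d + n"
  define L where "L = mat m m (\<lambda>(i, j). if j \<le> i then fps_nth D (i - j) else 0)"
  define H where "H = mat m m (\<lambda>(i, j). fps_nth F (0 + i + j))"
  define A where "A = mat (Suc d) (Suc d)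
    (\<lambda>(i, j). if d \<le> i + j then fps_nth D (i + j - d) else 0)"
  \<comment> \<open>Counting both indices from \<open>Suc d\<close> turns \<open>i + j - d\<close>
    into \<open>d + 2 + i + j\<close>.\<close>
  define B where "B = mat n n (\<lambda>(i, j). fps_nth D (d + 2 + i + j))"
  have L: "L \<in> carrier_mat m m" and H: "H \<in> carrier_mat m m"
    by (simp_all add: L_def H_def)
  have det_L: "det L = 1"
    by (subst det_lower_triangular [OF _ L]) (auto simp: L_def prod_list_diag_prod D0)
  have trunc: "(\<Sum>a = 0..<m. (if a \<le> i then f a else 0) * g a) = (\<Sum>a\<le>i. f a * g a)"
    if "i < m" for i and f g :: "nat \<Rightarrow> 'a"
    using that by (intro sum.mono_neutral_cong_right) auto
  have HL: "(H * transpose_mat L) $$ (a, j) = fps_nth (D * fps_shift a F) j"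
    if "a < m" "j < m" for a j
  proof -
    have "(H * transpose_mat L) $$ (a, j)
        = (\<Sum>b = 0..<m. (if b \<le> j then fps_nth D (j - b) else 0) * fps_nth F (a + b))"
      using that by (simp add: H_def L_def scalar_prod_def mult.commute)
    also have "\<dots> = fps_nth (fps_shift a F * D) j"
      using that unfolding fps_mult_nth atLeast0AtMost
      by (subst trunc) (simp_all add: ac_simps)
    finally show ?thesis by (simp add: mult.commute)
  qed
  have "L * (H * transpose_mat L) = four_block_mat A (0\<^sub>m (Suc d) n) (0\<^sub>m n (Suc d)) ((-1) \<cdot>\<^sub>m B)"
    (is "?M = ?R")
  proof (rule eq_matI)
    fix i j assume "i < dim_row ?R" "j < dim_col ?R"
    then have ij: "i < m" "j < m" by (simp_all add: A_def B_def m_def)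
    have "?M $$ (i, j) = (\<Sum>a = 0..<m. (if a \<le> i then fps_nth D (i - a) else 0)
        * (H * transpose_mat L) $$ (a, j))"
      using ij L H by (simp add: scalar_prod_def) (simp add: L_def)
    also have "\<dots> = (\<Sum>a = 0..<m. (if a \<le> i then fps_nth D (i - a) else 0)
        * fps_nth (D * fps_shift a F) j)"
      using ij by (intro sum.cong refl) (simp add: HL)
    also have "\<dots> = (\<Sum>a\<le>i. fps_nth D (i - a) * fps_nth (D * fps_shift a F) j)"
      using ij by (subst trunc) simp_all
    also have "\<dots> = (if i \<le> d \<and> j \<le> d then if d \<le> i + j then fps_nth D (i + j - d) else 0
        else if d < i \<and> d < j then - fps_nth D (i + j - d) else 0)"
      by (rule toeplitz_hankel_toeplitz_entry [OF FD])
    also have "\<dots> = ?R $$ (i, j)"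
    proof (cases "d < i \<and> d < j")
      case True
      then obtain i' j' where "i = Suc d + i'" "j = Suc d + j'"
        by (metis less_iff_Suc_add add_Suc)
      then show ?thesis
        using ij by (simp add: A_def B_def m_def add_ac)
    next
      case False
      then show ?thesis
        using ij by (auto simp: A_def B_def m_def not_less less_Suc_eq_le)
    qed
    finally show "?M $$ (i, j) = ?R $$ (i, j)" .
  qed (simp_all add: L_def A_def B_def m_def)
  moreover have "det ?M = det H"
    using L H by (simp add: det_mult [of _ m] det_transpose [of _ m] det_L)
  moreover have "det ?R = det A * det ((-1) \<cdot>\<^sub>m B)"
    by (rule det_four_block_mat_upper_right_zero) (auto simp: A_def B_def)
  moreover have "det A = (-1) ^ (d * Suc d div 2)"
    unfolding A_def det_antitriangular_toeplitz D0 by simp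
  moreover have "det ((-1) \<cdot>\<^sub>m B) = (-1) ^ n * det B"
    by (simp add: B_def)
  ultimately have "det H = (-1) ^ (d * Suc d div 2) * ((-1) ^ n * det B)"
    by (simp only:)
  then have "det H = (-1) ^ (n + d * Suc d div 2) * det B"
    by (simp add: power_add mult_ac)
  then show ?thesis
    by (simp add: hankel_det_def H_def B_def m_def add.commute [of n])
qed

text \<open>From index \<open>e\<close> on, the denominator has the coefficients of
  \<open>G\<close>, since \<open>u\<close> stops before. As \<open>e\<close> is a variable of its
  own, instances can have a numeral as exponent.\<close>

lemma hankel_det_continued_fraction:
  fixes F u G :: "'a::idom fps"
  assumes "F * (u + fps_X ^ e * G) = fps_X ^ d" and e: "d + 2 = e"
    and u: "fps_nth u 0 = 1" "\<And>i. e \<le> i \<Longrightarrow> fps_nth u i = 0"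
  shows "hankel_det F 0 (n + Suc d) = (-1) ^ (n + d * Suc d div 2) * hankel_det G 0 n"
proof -
  have "hankel_det F 0 (n + Suc d)
      = (-1) ^ (n + d * Suc d div 2) * hankel_det (u + fps_X ^ e * G) e n"
    using assms(1) u(1) unfolding e [symmetric] by (intro hankel_det_power_over) simp_all
  also have "fps_nth (u + fps_X ^ e * G) (e + i + j) = fps_nth G (i + j)" for i j
    by (simp add: u(2) fps_X_power_mult_nth add.assoc)
  then have "hankel_det (u + fps_X ^ e * G) e n = hankel_det G 0 n"
    by (simp add: hankel_det_def)
  finally show ?thesis .
qed

lemma hankel_det_uminus: "hankel_det (- f) l n = (-1) ^ n * hankel_det f l n"
proof -
  have "mat n n (\<lambda>(i, j). fps_nth (- f) (l + i + j))
      = (-1) \<cdot>\<^sub>m mat n n (\<lambda>(i, j). fps_nth f (l + i + j))"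
    by (rule eq_matI) auto
  then show ?thesis
    unfolding hankel_det_def by simp
qed

lemma hankel_det_shift: "hankel_det (fps_shift k f) 0 n = hankel_det f k n"
  by (simp add: hankel_det_def add_ac)

lemma hankel_det_1: "hankel_det f l 1 = fps_nth f l"
  unfolding hankel_det_def by (subst det_single) auto

lemma hankel_det_2:
  "hankel_det f l 2 = fps_nth f l * fps_nth f (l + 2) - fps_nth f (l + 1) ^ 2"
proof -
  let ?A = "mat 2 2 (\<lambda>(i, j). fps_nth f (l + i + j))"
  have "det ?A = (\<Sum>j<2. ?A $$ (0, j) * cofactor ?A 0 j)"
    by (rule laplace_expansion_row) auto
  also have "\<dots> = fps_nth f l * fps_nth f (l + 2) - fps_nth f (l + 1) ^ 2"
  proof -
    have "det (mat_delete ?A 0 j) = mat_delete ?A 0 j $$ (0, 0)" for j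
      by (rule det_single) (simp add: mat_delete_def)
    then show ?thesis
      by (simp add: numeral_2_eq_2 cofactor_def) (simp add: mat_delete_def)
  qed
  finally show ?thesis
    by (simp add: hankel_det_def)
qed

section \<open>The silver series and the equation of its tail\<close>

text \<open>Determinants of size at most 2 with \<open>l \<le> 3\<close> involve no index beyond
  5.\<close>

lemma silver_coeff_values:
  "silver_coeff 0 = 1" "silver_coeff 1 = 1" "silver_coeff 2 = 0"
  "silver_coeff 3 = 0" "silver_coeff 4 = 1" "silver_coeff 5 = 0"
  by code_simp+

text \<open>This is \<open>S\<^sub>3\<close>. The other three series are polynomials in
  \<open>fps_X\<close> and this one, so its equation serves all four cases.\<close>

definition silver_tail :: "int fps" where
  "silver_tail = fps_shift 3 silver_fps"

lemma silver_fps_eq_tail: "silver_fps = 1 + fps_X + fps_X ^ 3 * silver_tail"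
proof (rule fps_ext)
  fix n :: nat
  consider "n = 0" | "n = 1" | "n = 2" | "n \<ge> 3" by linarith
  then show "fps_nth silver_fps n = fps_nth (1 + fps_X + fps_X ^ 3 * silver_tail) n"
    by cases (auto simp: fps_X_power_mult_nth silver_tail_def silver_fps_eq silver_coeff_values
        simp flip: One_nat_def)
qed

text \<open>After substituting for \<open>silver_fps\<close>, every term of the quadratic equation
  except 1 is divisible by \<open>fps_X ^ 3\<close>, which cancels.\<close>

lemma silver_tail_equation:
  "silver_tail * (1 + 2 * fps_X ^ 2 - fps_X ^ 3 + fps_X ^ 4 * silver_tail) = fps_X"
proof -
  let ?S = silver_fps
  have "fps_X * ?S^2 + (1 - 2 * fps_X - fps_X^3) * ?S = 1"
    by (simp add: silver_fps_iff)
  moreover have "fps_X * ?S^2 + (1 - 2 * fps_X - fps_X^3) * ?S = 1 +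
      fps_X ^ 3 * (silver_tail * (1 + 2 * fps_X ^ 2 - fps_X ^ 3 + fps_X ^ 4 * silver_tail) - fps_X)"
    unfolding silver_fps_eq_tail by (simp add: algebra_simps eval_nat_numeral)
  ultimately have
    "fps_X ^ 3 * (silver_tail * (1 + 2 * fps_X ^ 2 - fps_X ^ 3 + fps_X ^ 4 * silver_tail) - fps_X) = 0"
    by simp
  then show ?thesis
    by simp
qed

lemma silver_shifts:
  "fps_shift 1 silver_fps = 1 + fps_X ^ 2 * silver_tail"
  "fps_shift 2 silver_fps = fps_X * silver_tail"
  by (subst silver_fps_eq_tail, auto simp: fps_eq_iff fps_X_power_mult_nth)+

section \<open>Continued fraction steps from each shift to the next\<close>

lemma fps_inverse_exists:
  fixes f :: "'a::comm_ring_1 fps"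
  assumes "fps_nth f 0 = 1"
  obtains g where "g * f = 1"
  using fps_right_inverse [of f 1] assms by (metis mult.commute mult.right_neutral)

text \<open>One division step: \<open>w / (a w + b) = 1 / (a + b / w)\<close>, with \<open>g\<close>
  as \<open>1 / w\<close>.\<close>

lemma mult_eq_1_of_inverse:
  fixes f g w a b :: "'a::comm_ring_1"
  assumes g: "g * w = 1" and f: "f * (a * w + b) = w"
  shows "f * (a + b * g) = 1"
proof -
  have "f * (a + b * g) = g * (f * (a * w + b)) + f * a * (1 - g * w)"
    by (simp add: algebra_simps)
  then show ?thesis by (simp add: f g)
qed

abbreviation silver_step :: "int fps" where
  "silver_step \<equiv> 1 - fps_X + fps_X ^ 2 * silver_tail"

text \<open>The first step from \<open>S\<^sub>0\<close>, kept separate because the case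
  \<open>l = 3\<close> ends in the same \<open>silver_step\<close>.\<close>

lemma hankel_det_silver_0_Suc:
  "hankel_det silver_fps 0 (n + 1) = (-1) ^ n * hankel_det silver_step 0 n"
proof -
  have "silver_fps * (1 - fps_X + fps_X ^ 2 * silver_step) = 1 + fps_X ^ 3 *
      (silver_tail * (1 + 2 * fps_X ^ 2 - fps_X ^ 3 + fps_X ^ 4 * silver_tail) - fps_X)"
    unfolding silver_fps_eq_tail by (simp add: algebra_simps eval_nat_numeral)
  then have "silver_fps * (1 - fps_X + fps_X ^ 2 * silver_step) = 1"
    unfolding silver_tail_equation by simp
  then show ?thesis
    using hankel_det_continued_fraction [of silver_fps "1 - fps_X" 2 silver_step 0 n]
    by (simp add: fps_numeral_fps_const)
qed

text \<open>Three steps of size 1: \<open>silver_step = 1 / (1 + x + x^2 Q)\<close> and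
  \<open>Q = 1 / (1 + x^2 S\<^sub>1)\<close> follow the first one.\<close>

lemma hankel_det_silver_0:
  "hankel_det silver_fps 0 (n + 3) = (-1) ^ (n + 1) * hankel_det silver_fps 1 n"
proof -
  let ?W = "1 + fps_X ^ 2 * fps_shift 1 silver_fps"
  obtain Q where Q: "Q * ?W = 1"
    by (rule fps_inverse_exists [of ?W]) simp
  have "silver_step * ((1 + fps_X) * ?W + fps_X ^ 2) = ?W + fps_X ^ 2 * (1 + fps_X) *
      (silver_tail * (1 + 2 * fps_X ^ 2 - fps_X ^ 3 + fps_X ^ 4 * silver_tail) - fps_X)"
    unfolding silver_shifts by (simp add: algebra_simps eval_nat_numeral)
  then have "silver_step * ((1 + fps_X) * ?W + fps_X ^ 2) = ?W"
    unfolding silver_tail_equation by simp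
  with Q have "silver_step * (1 + fps_X + fps_X ^ 2 * Q) = 1"
    by (rule mult_eq_1_of_inverse)
  then have "hankel_det silver_step 0 (m + 1) = (-1) ^ m * hankel_det Q 0 m" for m
    using hankel_det_continued_fraction [of silver_step "1 + fps_X" 2 Q 0 m]
    by (simp add: fps_numeral_fps_const)
  moreover have "hankel_det Q 0 (m + 1) = (-1) ^ m * hankel_det silver_fps 1 m" for m
    using hankel_det_continued_fraction [of Q 1 2 "fps_shift 1 silver_fps" 0 m] Q
    by (simp add: fps_numeral_fps_const hankel_det_shift)
  ultimately show ?thesis
    using hankel_det_silver_0_Suc [of "n + 2"] by (simp add: numeral_3_eq_3)
qed

text \<open>Steps of sizes 1 and 2: \<open>S\<^sub>1 = 1 / (1 - x^2 (x R))\<close> and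
  \<open>x R = x / (1 + 2 x^2 + x^3 S\<^sub>2)\<close>.\<close>

lemma hankel_det_silver_1:
  "hankel_det silver_fps 1 (n + 3) = (-1) ^ (n + 1) * hankel_det silver_fps 2 n"
proof -
  let ?W = "1 + 2 * fps_X ^ 2 + fps_X ^ 3 * fps_shift 2 silver_fps"
  obtain R where R: "R * ?W = 1"
    by (rule fps_inverse_exists [of ?W]) simp
  have "fps_shift 1 silver_fps * (1 * ?W + - (fps_X ^ 3)) = ?W + fps_X ^ 2 *
      (silver_tail * (1 + 2 * fps_X ^ 2 - fps_X ^ 3 + fps_X ^ 4 * silver_tail) - fps_X)"
    unfolding silver_shifts by (simp add: algebra_simps eval_nat_numeral)
  then have "fps_shift 1 silver_fps * (1 * ?W + - (fps_X ^ 3)) = ?W"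
    unfolding silver_tail_equation by simp
  with R have "fps_shift 1 silver_fps * (1 + - (fps_X ^ 3) * R) = 1"
    by (rule mult_eq_1_of_inverse)
  then have "fps_shift 1 silver_fps * (1 + fps_X ^ 2 * (- (fps_X * R))) = 1"
    by (simp add: eval_nat_numeral mult.assoc)
  \<comment> \<open>The sign of the step cancels against that of negating
    \<open>fps_X * R\<close>.\<close>
  then have "hankel_det silver_fps 1 (m + 1) = hankel_det (fps_X * R) 0 m" for m
    using hankel_det_continued_fraction [of "fps_shift 1 silver_fps" 1 2 "- (fps_X * R)" 0 m]
    by (simp add: fps_numeral_fps_const hankel_det_shift hankel_det_uminus flip: power_add)
  moreover have "fps_X * R * ?W = fps_X"
    by (simp only: mult.assoc R mult_1_right)
  then have "hankel_det (fps_X * R) 0 (n + 2) = (-1) ^ (n + 1) * hankel_det silver_fps 2 n"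
    using hankel_det_continued_fraction
      [of "fps_X * R" "1 + 2 * fps_X ^ 2" 3 "fps_shift 2 silver_fps" 1 n]
    by (simp add: fps_numeral_fps_const hankel_det_shift)
  ultimately show ?thesis
    by (simp add: numeral_3_eq_3)
qed

text \<open>The tail equation times \<open>fps_X\<close> is a single step of size 3.\<close>

lemma hankel_det_silver_2:
  "hankel_det silver_fps 2 (n + 3) = (-1) ^ (n + 1) * hankel_det silver_fps 3 n"
proof -
  have "fps_shift 2 silver_fps * (1 + 2 * fps_X ^ 2 - fps_X ^ 3 + fps_X ^ 4 * silver_tail) = fps_X ^ 2"
    unfolding silver_shifts mult.assoc silver_tail_equation by (rule power2_eq_square [symmetric])
  then show ?thesis
    using hankel_det_continued_fraction
      [of "fps_shift 2 silver_fps" "1 + 2 * fps_X ^ 2 - fps_X ^ 3" 4 silver_tail 2 n]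
    by (simp add: fps_numeral_fps_const hankel_det_shift silver_tail_def power_add)
qed

text \<open>Here \<open>S\<^sub>3 = x / (1 + 2 x^2 - x^3 L)\<close> and
  \<open>L = 1 / (1 + x^2 Z)\<close> are steps of sizes 2 and 1.\<close>

lemma hankel_det_silver_3:
  "hankel_det silver_fps 3 (n + 3) = (-1) ^ (n + 1) * hankel_det silver_fps 0 n"
proof -
  let ?W = "1 + fps_X ^ 2 * silver_step"
  define L where "L = 1 - fps_X * silver_tail"
  obtain Z where Z: "Z * ?W = 1"
    by (rule fps_inverse_exists [of ?W]) simp
  have "silver_tail * (1 + 2 * fps_X ^ 2 + fps_X ^ 3 * (- L)) = fps_X"
    using silver_tail_equation by (simp add: L_def algebra_simps eval_nat_numeral)
  then have "hankel_det silver_fps 3 (m + 2) = - hankel_det L 0 m" for m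
    using hankel_det_continued_fraction [of silver_tail "1 + 2 * fps_X ^ 2" 3 "- L" 1 m]
    by (simp add: fps_numeral_fps_const hankel_det_shift hankel_det_uminus silver_tail_def flip: power_add)
  moreover have "L * (1 * ?W + fps_X ^ 2) = ?W - fps_X *
      (silver_tail * (1 + 2 * fps_X ^ 2 - fps_X ^ 3 + fps_X ^ 4 * silver_tail) - fps_X)"
    by (simp add: L_def algebra_simps eval_nat_numeral)
  then have "L * (1 * ?W + fps_X ^ 2) = ?W"
    unfolding silver_tail_equation by simp
  with Z have "L * (1 + fps_X ^ 2 * Z) = 1"
    by (rule mult_eq_1_of_inverse)
  then have "hankel_det L 0 (n + 1) = (-1) ^ n * hankel_det Z 0 n"
    using hankel_det_continued_fraction [of L 1 2 Z 0 n] by (simp add: fps_numeral_fps_const)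
  \<comment> \<open>\<open>Z\<close> and \<open>silver_fps\<close> differ only in \<open>u\<close>,
    which is \<open>1\<close> and \<open>1 - fps_X\<close>; the determinants do not depend on
    it.\<close>
  moreover have "hankel_det Z 0 n = hankel_det silver_fps 0 n"
  proof (cases n)
    case 0
    then show ?thesis by (simp add: hankel_det_0)
  next
    case (Suc m)
    have "hankel_det Z 0 (m + 1) = (-1) ^ m * hankel_det silver_step 0 m"
      using hankel_det_continued_fraction [of Z 1 2 silver_step 0 m] Z by (simp add: fps_numeral_fps_const)
    with Suc show ?thesis
      using hankel_det_silver_0_Suc [of m] by simp
  qed
  ultimately show ?thesis
    by (simp add: numeral_3_eq_3)
qed

section \<open>Periodicity, range and table of values\<close>

theorem theorem1p8:
  shows "(\<forall>l\<in>{0, 1, 2, 3}.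
            (\<forall>n. hankel_det silver_fps l (n + 12) = hankel_det silver_fps l n) \<and>
            (\<forall>n. hankel_det silver_fps l n \<in> {-1, 0, 1})) \<and>
         map (hankel_det silver_fps 0) [0..<12] = [1, 1, -1, -1, 1, 0, -1, 0, 0, 1, 0, -1] \<and>
         map (hankel_det silver_fps 1) [0..<12] = [1, 1, 0, -1, 0, 0, -1, 0, 1, 1, -1, -1] \<and>
         map (hankel_det silver_fps 2) [0..<12] = [1, 0, 0, -1, 0, 1, -1, -1, 1, 1, -1, 0] \<and>
         map (hankel_det silver_fps 3) [0..<12] = [1, 0, -1, -1, 1, 1, -1, -1, 0, 1, 0, 0] \<and>
         (\<forall>l\<in>{0, 1, 2}. \<forall>n.
            hankel_det silver_fps (l + 1) n = (-1) ^ (n + 1) * hankel_det silver_fps l (n + 3))"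
proof -
  let ?\<Delta> = "hankel_det silver_fps"
  note rec = hankel_det_silver_0 hankel_det_silver_1 hankel_det_silver_2 hankel_det_silver_3
  have init: "?\<Delta> 0 0 = 1" "?\<Delta> 0 1 = 1" "?\<Delta> 0 2 = -1"
    "?\<Delta> 1 0 = 1" "?\<Delta> 1 1 = 1" "?\<Delta> 1 2 = 0"
    "?\<Delta> 2 0 = 1" "?\<Delta> 2 1 = 0" "?\<Delta> 2 2 = 0"
    "?\<Delta> 3 0 = 1" "?\<Delta> 3 1 = 0" "?\<Delta> 3 2 = -1"
    by (simp_all add: hankel_det_0 hankel_det_1 hankel_det_2 silver_fps_eq silver_coeff_values
        del: One_nat_def Suc_1 add_2_eq_Suc' add_2_eq_Suc)
  \<comment> \<open>Four steps return to the same \<open>l\<close>; their sign exponents add up to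
    the even number \<open>4 * n + 22\<close>.\<close>
  have periodic: "?\<Delta> l (n + 12) = ?\<Delta> l n" if "l \<in> {0, 1, 2, 3}" for l n
    using that rec(1-4) [of "n + 9"] rec(1-4) [of "n + 6"] rec(1-4) [of "n + 3"] rec(1-4) [of n]
    by (cases "even n") (auto simp: add.commute [of n])
  have range: "\<forall>l\<in>{0, 1, 2, 3}. ?\<Delta> l n \<in> {-1, 0, 1}" for n
  proof (induction n rule: less_induct)
    case (less n)
    consider "n = 0" | "n = 1" | "n = 2" | "3 \<le> n" by linarith
    then show ?case
    proof cases
      case 4
      then obtain m where m: "n = m + 3"
        using le_Suc_ex add.commute by metis
      then have "m < n" by simp
      note IH = less [OF this]
      have signed: "(-1) ^ (m + 1) * ?\<Delta> l m \<in> {-1, 0, 1}" if "l \<in> {0, 1, 2, 3}" for l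
        using bspec [OF IH that] by (cases "even m") auto
      show ?thesis
        unfolding m by (intro ballI, elim insertE emptyE; simp only: rec; rule signed; simp)
    qed (use init in auto)
  qed
  \<comment> \<open>Numerals do not match the pattern \<open>n + 3\<close>, so the instances are
    spelled out; rewriting with them ends in \<open>init\<close>.\<close>
  have rec_values: "?\<Delta> l 3 = - ?\<Delta> l' 0" "?\<Delta> l 4 = ?\<Delta> l' 1" "?\<Delta> l 5 = - ?\<Delta> l' 2"
    "?\<Delta> l 6 = ?\<Delta> l' 3" "?\<Delta> l 7 = - ?\<Delta> l' 4" "?\<Delta> l 8 = ?\<Delta> l' 5"
    "?\<Delta> l 9 = - ?\<Delta> l' 6" "?\<Delta> l 10 = ?\<Delta> l' 7" "?\<Delta> l 11 = - ?\<Delta> l' 8"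
    if "\<And>n. ?\<Delta> l (n + 3) = (-1) ^ (n + 1) * ?\<Delta> l' n" for l l'
    using that [of 0] that [of 1] that [of 2] that [of 3] that [of 4] that [of 5]
      that [of 6] that [of 7] that [of 8] by simp_all
  note table = init rec_values [OF rec(1)] rec_values [OF rec(2)]
    rec_values [OF rec(3)] rec_values [OF rec(4)]
  have upt: "[0..<12] = [0, 1, 2, 3, 4, 5, 6, 7, 8, 9, 10, 11::nat]"
    by (simp add: upt_rec)
  \<comment> \<open>The exponent \<open>n + 1\<close> has the parity of \<open>n - 1\<close> and
    avoids truncated subtraction at \<open>n = 0\<close>.\<close>
  have shift: "?\<Delta> (l + 1) n = (-1) ^ (n + 1) * ?\<Delta> l (n + 3)" if "l \<in> {0, 1, 2}" for l n
  proof -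
    have "?\<Delta> l (n + 3) = (-1) ^ (n + 1) * ?\<Delta> (l + 1) n"
      using that rec(1-3) [of n] by (auto simp: numeral_2_eq_2 numeral_3_eq_3)
    then show ?thesis
      by (simp flip: mult.assoc power_add)
  qed
  show ?thesis
    unfolding upt list.map table by (intro conjI ballI allI) (rule periodic bspec [OF range] shift | simp)+
qed

end
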